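(* Let $k\ge 0$ be an integer and let $K_{3,3}$ be the complete bipartite graph with both parts of size 3. Then \[\ddot{\gamma}_P^k(K_{3,3})= k + \left\lfloor \frac{k}{5} \right\rfloor + 2.\]
   Context: Graphs are finite and simple. For a vertex $v$, $N[v]$ denotes its closed neighborhood. The power domination process on a graph $G$ with initial set $S\subseteq V(G)$: (1) set $B=\bigcup_{v\in S}N[v]$; (2) while there is $v\in B$ with exactly one neighbor $u\notin B$, add $u$ to $B$. A set $S$ is a power dominating set of $G$ if $B=V(G)$ when the process terminates. A multiset of vertices is called a power dominating set if its underlying set is one. For an integer $k\ge 0$, a $k$-robust power dominating set of $G$ is a finite multiset $S$ of elements of $V(G)$ with $|S|\ge k$ (counted with multiplicity) such that for every submultiset $F$ of $S$ with $|F|=k$, the multiset difference $S\setminus F$ is a power dominating set of $G$. $\ddot{\gamma}_P^k(G)$ denotes the minimum cardinality (with multiplicity) of a $k$-robust power dominating set of $G$. *)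

theory Defs
  imports Complex_Main "HOL-Library.Multiset" "Graph_Theory.Kuratowski"
begin

(* Finite simple graphs are the locale graph of Graph_Theory: finite, symmetric, loop-free
   digraphs without parallel arcs. u dominates v there means that u and v are adjacent. *)

definition nbhd :: "('a, 'b) pre_digraph \<Rightarrow> 'a \<Rightarrow> 'a set" where
  "nbhd G v = {u. v \<rightarrow>\<^bsub>G\<^esub> u}"

definition closed_nbhd :: "('a, 'b) pre_digraph \<Rightarrow> 'a \<Rightarrow> 'a set" where
  "closed_nbhd G v = insert v (nbhd G v)"

inductive pd_step :: "('a, 'b) pre_digraph \<Rightarrow> 'a set \<Rightarrow> 'a set \<Rightarrow> bool" for G where
  "v \<in> B \<Longrightarrow> nbhd G v - B = {u} \<Longrightarrow> pd_step G B (insert u B)"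

(* B is a possible final set of the process started from S. The process may choose freely among
   the applicable steps; pd_outcome_unique below shows that the final set does not depend on
   these choices. *)
definition pd_outcome :: "('a, 'b) pre_digraph \<Rightarrow> 'a set \<Rightarrow> 'a set \<Rightarrow> bool" where
  "pd_outcome G S B \<longleftrightarrow>
     (pd_step G)\<^sup>*\<^sup>* (\<Union>v\<in>S. closed_nbhd G v) B \<and> (\<nexists>B'. pd_step G B B')"

definition power_dominating :: "('a, 'b) pre_digraph \<Rightarrow> 'a set \<Rightarrow> bool" where
  "power_dominating G S \<longleftrightarrow> S \<subseteq> verts G \<and> pd_outcome G S (verts G)"

definition robust_power_dominating :: "nat \<Rightarrow> ('a, 'b) pre_digraph \<Rightarrow> 'a multiset \<Rightarrow> bool" where
  "robust_power_dominating k G S \<longleftrightarrow>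
     set_mset S \<subseteq> verts G \<and> k \<le> size S \<and>
     (\<forall>F. F \<subseteq># S \<and> size F = k \<longrightarrow> power_dominating G (set_mset (S - F)))"

(* The infimum of a nonempty set of naturals is attained; on the empty set Inf gives 0. *)
definition robust_power_domination_number :: "nat \<Rightarrow> ('a, 'b) pre_digraph \<Rightarrow> nat" where
  "robust_power_domination_number k G = Inf {size S | S. robust_power_dominating k G S}"

lemma pd_reach_subset_terminal:
  assumes "(pd_step G)\<^sup>*\<^sup>* A B" "A \<subseteq> C" "\<nexists>C'. pd_step G C C'"
  shows "B \<subseteq> C"
  using assms(1)
proof (induction rule: rtranclp_induct)
  case base
  show ?case by fact
next
  case (step B B')
  from step.hyps(2) obtain v u where *: "v \<in> B" "nbhd G v - B = {u}" "B' = insert u B"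
    by (auto elim: pd_step.cases)
  have "u \<in> C"
  proof (rule ccontr)
    assume "u \<notin> C"
    then have "nbhd G v - C = {u}" using *(2) step.IH by blast
    then show False using pd_step.intros[of v C G u] *(1) step.IH assms(3) by blast
  qed
  then show ?case using * step.IH by blast
qed

lemma pd_reach_superset: "(pd_step G)\<^sup>*\<^sup>* A B \<Longrightarrow> A \<subseteq> B"
  by (induction rule: rtranclp_induct) (auto elim!: pd_step.cases)

lemma pd_terminal_exists:
  assumes "graph G" "A \<subseteq> verts G"
  shows "\<exists>B. (pd_step G)\<^sup>*\<^sup>* A B \<and> (\<nexists>B'. pd_step G B B')"
  using assms(2)
proof (induction "card (verts G - A)" arbitrary: A rule: less_induct)
  case less
  interpret graph G by fact
  show ?case
  proof (cases "\<exists>A'. pd_step G A A'")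
    case True
    then obtain v u where vu: "v \<in> A" "nbhd G v - A = {u}"
      by (auto elim: pd_step.cases)
    note * = vu pd_step.intros[of v A G u, OF vu]
    have "u \<in> nbhd G v" "u \<notin> A" using *(2) by blast+
    then have u: "u \<in> verts G - A" by (auto simp: nbhd_def)
    then have "card (verts G - insert u A) < card (verts G - A)"
      by (intro psubset_card_mono) auto
    with less.hyps[of "insert u A"] less.prems u obtain B
      where "(pd_step G)\<^sup>*\<^sup>* (insert u A) B" "\<nexists>B'. pd_step G B B'" by auto
    then show ?thesis using *(3) by (meson converse_rtranclp_into_rtranclp)
  qed blast
qed

lemma pd_outcome_unique:
  assumes "graph G" "S \<subseteq> verts G"
  shows "\<exists>!B. pd_outcome G S B"
proof -
  interpret graph G by fact
  have "(\<Union>v\<in>S. closed_nbhd G v) \<subseteq> verts G"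
    using assms(2) by (auto simp: closed_nbhd_def nbhd_def)
  from pd_terminal_exists[OF assms(1) this] obtain B where "pd_outcome G S B"
    by (auto simp: pd_outcome_def)
  moreover have "B1 \<subseteq> B2" if "pd_outcome G S B1" "pd_outcome G S B2" for B1 B2
    using that pd_reach_subset_terminal pd_reach_superset unfolding pd_outcome_def by metis
  ultimately show ?thesis by blast
qed

end

(* In K_{3,3} a single vertex observes itself and the opposite part, after which every observed
   vertex has zero or two unobserved neighbours, so the process is stuck; two distinct vertices
   always suffice. Hence S is k-robust iff no vertex v carries |S| - k or more of its elements,
   i.e. iff count S v + k < |S| for all v. Summing over the six vertices gives
   |S| <= 6 (|S| - k - 1), which is the lower bound, and it is attained by any multiset of size
   k + k div 5 + 2 with all multiplicities at most k div 5 + 1. *)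

theory Submission
  imports Defs
begin

section \<open>Submultisets and general criteria for power domination\<close>

lemma exists_submset_of_size:
  assumes "n \<le> size M"
  shows "\<exists>F. F \<subseteq># M \<and> size F = n"
proof -
  obtain xs where xs: "mset xs = M" using ex_mset by blast
  have "mset (take n xs) \<subseteq># M"
    using xs by (metis append_take_drop_id mset_append mset_subset_eq_add_left)
  moreover have "size (mset (take n xs)) = n"
    using assms xs by auto
  ultimately show ?thesis by blast
qed

text \<open>The process is over before any propagation: a step from \<open>verts G\<close> would
  need a neighbour outside \<open>verts G\<close>.\<close>

lemma power_dominating_if_closed_nbhds_cover:
  assumes "S \<subseteq> verts G" "(\<Union>v\<in>S. closed_nbhd G v) = verts G" "\<And>v. nbhd G v \<subseteq> verts G"
  shows "power_dominating G S"
  using assms by (fastforce simp: power_dominating_def pd_outcome_def elim: pd_step.cases)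

lemma power_dominating_if_one_step:
  assumes "S \<subseteq> verts G" "pd_step G (\<Union>v\<in>S. closed_nbhd G v) (verts G)"
    and "\<And>v. nbhd G v \<subseteq> verts G"
  shows "power_dominating G S"
proof -
  have "\<not> pd_step G (verts G) B" for B
    using assms(3) by (fastforce elim: pd_step.cases)
  then show ?thesis
    using assms(1,2) by (auto simp: power_dominating_def pd_outcome_def)
qed

text \<open>A set without successor is the only one reachable from itself, so the process ends
  there, short of \<open>verts G\<close>.\<close>

lemma not_power_dominating_if_stuck:
  assumes "\<nexists>B. pd_step G (\<Union>v\<in>S. closed_nbhd G v) B" "(\<Union>v\<in>S. closed_nbhd G v) \<noteq> verts G"
  shows "\<not> power_dominating G S"
  using assms unfolding power_dominating_def pd_outcome_def by (metis converse_rtranclpE)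

section \<open>Power domination in K_{3,3}\<close>

locale K33 =
  fixes G :: "('a, 'b) pre_digraph" and U V :: "'a set"
  assumes verts: "verts G = U \<union> V" and disj: "U \<inter> V = {}"
    and cards: "card U = 3" "card V = 3" and arcs: "arcs_ends G = U \<times> V \<union> V \<times> U"
begin

text \<open>Facts proved for vertices of the first part transfer to the second through this
  symmetry.\<close>

lemma swap: "K33 G V U"
  using verts disj cards arcs by unfold_locales auto

lemma nbhd_left: "u \<in> U \<Longrightarrow> nbhd G u = V"
  using disj by (auto simp: nbhd_def arcs)

lemma nbhd_right: "v \<in> V \<Longrightarrow> nbhd G v = U"
  using disj by (auto simp: nbhd_def arcs)

lemma nbhd_subset: "nbhd G v \<subseteq> verts G"
  by (auto simp: nbhd_def arcs verts)

lemma parts_nonempty: "U \<noteq> {}" "V \<noteq> {}"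
  using cards by auto

lemma singleton_not_power_dominating_left:
  assumes "u \<in> U"
  shows "\<not> power_dominating G {u}"
proof (rule not_power_dominating_if_stuck)
  have B: "(\<Union>v\<in>{u}. closed_nbhd G v) = insert u V"
    using assms by (simp add: closed_nbhd_def nbhd_left)
  \<comment> \<open>Every vertex of \<open>V\<close> is adjacent to both of these unobserved
    vertices, while \<open>u\<close> is adjacent to neither. The count thus shows both that no step
    applies and that the observed set is not everything.\<close>
  have U_minus: "card (U - insert u V) = 2"
  proof -
    have "U - insert u V = U - {u}" using disj by auto
    then show ?thesis using assms cards by simp
  qed
  have "\<not> pd_step G (insert u V) B" for B
  proof
    assume "pd_step G (insert u V) B"
    then obtain v w where vw: "v \<in> insert u V" "nbhd G v - insert u V = {w}"
      using pd_step.cases by meson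
    show False
    proof (cases "v = u")
      case True
      then show False using vw(2) nbhd_left[OF assms] by auto
    next
      case False
      then have "U - insert u V = {w}" using vw nbhd_right[of v] by simp
      then show False using U_minus by simp
    qed
  qed
  then show "\<nexists>B. pd_step G (\<Union>v\<in>{u}. closed_nbhd G v) B"
    unfolding B by blast
  show "(\<Union>v\<in>{u}. closed_nbhd G v) \<noteq> verts G"
  proof
    assume "(\<Union>v\<in>{u}. closed_nbhd G v) = verts G"
    then have "U - insert u V = {}" unfolding B verts by blast
    then show False using U_minus by (metis card.empty zero_neq_numeral)
  qed
qed

lemma two_left_power_dominating:
  assumes "S \<subseteq> verts G" "u \<in> S" "u' \<in> S" "u \<noteq> u'" "u \<in> U" "u' \<in> U"
  shows "power_dominating G S"
proof (cases "(\<Union>v\<in>S. closed_nbhd G v) = verts G")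
  \<comment> \<open>\<open>S\<close> may contain more than \<open>u\<close> and \<open>u'\<close>;
    if the third vertex of \<open>U\<close> is observed from the start, nothing is left to
    propagate. Otherwise it is the only unobserved vertex, and any vertex of \<open>V\<close> forces
    it.\<close>
  case True
  then show ?thesis
    using power_dominating_if_closed_nbhds_cover assms(1) nbhd_subset by blast
next
  case False
  define B where "B = (\<Union>v\<in>S. closed_nbhd G v)"
  have "card (U - {u, u'}) = 1"
    using assms cards by (simp add: card_Diff_subset)
  then obtain w where w: "U - {u, u'} = {w}"
    by (auto simp: card_1_singleton_iff)
  have uV: "{u, u'} \<union> V \<subseteq> B"
    using assms nbhd_left[of u] unfolding B_def closed_nbhd_def by blast
  have "B \<subseteq> verts G"
    using assms(1) nbhd_subset unfolding B_def closed_nbhd_def by blast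
  have U: "U \<subseteq> {u, u', w}" "w \<in> U" using w by blast+
  have "w \<notin> B"
  proof
    assume "w \<in> B"
    then have "verts G \<subseteq> B" using U(1) uV by (auto simp: verts)
    then show False using \<open>B \<subseteq> verts G\<close> False B_def by blast
  qed
  then have "U - B = {w}" using U uV by auto
  moreover have "insert w B = verts G"
    using U uV \<open>B \<subseteq> verts G\<close> by (auto simp: verts)
  moreover obtain v where "v \<in> V" using parts_nonempty by blast
  ultimately have "pd_step G B (verts G)"
    using pd_step.intros[of v B G w] uV nbhd_right by (metis Un_subset_iff subsetD)
  then have "pd_step G (\<Union>v\<in>S. closed_nbhd G v) (verts G)" by (simp add: B_def)
  then show ?thesis
    using power_dominating_if_one_step assms(1) nbhd_subset by blast
qed

text \<open>Each of the two vertices observes the whole part opposite to it.\<close>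

lemma mixed_power_dominating:
  assumes "S \<subseteq> verts G" "u \<in> S" "v \<in> S" "u \<in> U" "v \<in> V"
  shows "power_dominating G S"
proof (rule power_dominating_if_closed_nbhds_cover)
  have "U \<union> V \<subseteq> (\<Union>v\<in>S. closed_nbhd G v)"
    using assms nbhd_left[of u] nbhd_right[of v] unfolding closed_nbhd_def by blast
  then show "(\<Union>v\<in>S. closed_nbhd G v) = verts G"
    using assms(1) verts nbhd_subset by (auto simp: closed_nbhd_def)
qed (use assms(1) nbhd_subset in auto)

lemma power_dominating_iff_card:
  assumes "S \<subseteq> verts G"
  shows "power_dominating G S \<longleftrightarrow> 2 \<le> card S"
proof
  \<comment> \<open>Infinite sets have \<open>card\<close> 0, so parts of cardinality 3 are
    finite.\<close>
  have "finite S"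
    using assms cards verts by (metis card.infinite finite_UnI finite_subset zero_neq_numeral)
  {
    assume pd: "power_dominating G S"
    show "2 \<le> card S"
    proof (rule ccontr)
      assume "\<not> 2 \<le> card S"
      then consider "S = {}" | v where "S = {v}"
        using \<open>finite S\<close> by (metis One_nat_def card_0_eq card_1_singletonE less_2_cases not_less)
      then show False
      proof cases
        case 1
        have "\<nexists>B. pd_step G (\<Union>v\<in>{}. closed_nbhd G v) B" by (auto elim: pd_step.cases)
        then show False
          using pd 1 not_power_dominating_if_stuck[of G "{}"] parts_nonempty verts by auto
      next
        case 2
        then show False
          using pd assms singleton_not_power_dominating_left
            K33.singleton_not_power_dominating_left[OF swap] verts by auto
      qed
    qed
  next
    assume "2 \<le> card S"
    then obtain u v where uv: "u \<in> S" "v \<in> S" "u \<noteq> v"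
      using \<open>finite S\<close> by (metis card_2_iff' obtain_subset_with_card_n subset_iff)
    then consider "u \<in> U" "v \<in> U" | "u \<in> V" "v \<in> V" | "u \<in> U" "v \<in> V" | "u \<in> V" "v \<in> U"
      using assms verts by blast
    then show "power_dominating G S"
    proof cases
      case 1
      then show ?thesis using two_left_power_dominating[OF assms] uv by blast
    next
      case 2
      then show ?thesis using K33.two_left_power_dominating[OF swap assms] uv by blast
    next
      case 3
      then show ?thesis using mixed_power_dominating[OF assms] uv by blast
    next
      case 4
      then show ?thesis using mixed_power_dominating[OF assms] uv by blast
    qed
  }
qed

end

section \<open>Robustness as a bound on multiplicities\<close>

lemma two_le_card_after_removal_iff:
  assumes "set_mset S \<subseteq> A" "A \<noteq> {}"
  shows "k \<le> size S \<and> (\<forall>F. F \<subseteq># S \<and> size F = k \<longrightarrow> 2 \<le> card (set_mset (S - F)))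
    \<longleftrightarrow> (\<forall>v\<in>A. count S v + k < size S)"
proof
  assume L: "k \<le> size S \<and> (\<forall>F. F \<subseteq># S \<and> size F = k \<longrightarrow> 2 \<le> card (set_mset (S - F)))"
  show "\<forall>v\<in>A. count S v + k < size S"
  proof (intro ballI, rule ccontr)
    fix v
    assume "\<not> count S v + k < size S"
    \<comment> \<open>The worst deletion spares only copies of \<open>v\<close>. Since
      \<open>k \<le> size S\<close>, the truncated subtraction is exact and the complement of
      \<open>?R\<close> has size exactly \<open>k\<close>.\<close>
    let ?R = "replicate_mset (size S - k) v"
    have R: "?R \<subseteq># S"
      using \<open>\<not> count S v + k < size S\<close> by (simp add: count_le_replicate_mset_subset_eq[symmetric])
    then have "size (S - ?R) = k" "S - (S - ?R) = ?R"
      using L by (auto simp: size_Diff_submset subset_mset.diff_diff_right multiset_eq_iff subseteq_mset_def)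
    with L have "2 \<le> card (set_mset ?R)" by (metis diff_subset_eq_self)
    moreover have "card (set_mset ?R) \<le> 1" by auto
    ultimately show False by linarith
  qed
next
  assume R: "\<forall>v\<in>A. count S v + k < size S"
  have "2 \<le> card (set_mset (S - F))" if "F \<subseteq># S" "size F = k" for F
  proof (rule ccontr)
    assume neg: "\<not> 2 \<le> card (set_mset (S - F))"
    \<comment> \<open>If nothing survives, any element of \<open>A\<close> serves as
      \<open>v\<close>, so both ways of having fewer than two vertices are treated alike.\<close>
    have "\<exists>v\<in>A. set_mset (S - F) \<subseteq> {v}"
    proof (cases "set_mset (S - F) = {}")
      case True
      then show ?thesis using \<open>A \<noteq> {}\<close> by auto
    next
      case False
      then have "card (set_mset (S - F)) = 1"
        using neg by (metis One_nat_def card_0_eq finite_set_mset less_2_cases not_less)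
      then obtain v where "set_mset (S - F) = {v}" using card_1_singletonE by blast
      moreover from this have "v \<in> A"
        using assms(1) by (metis in_diffD insertI1 subsetD)
      ultimately show ?thesis by blast
    qed
    then obtain v where v: "v \<in> A" "set_mset (S - F) \<subseteq> {v}" by blast
    \<comment> \<open>The survivors are copies of \<open>v\<close> only, so their number
      \<open>size S - k\<close> is at most \<open>count S v\<close>, against the strict
      bound.\<close>
    then have "S - F = replicate_mset (count (S - F) v) v"
      by (intro multiset_eqI) (auto simp del: count_diff intro: count_inI)
    then have "size (S - F) = count (S - F) v" by (metis size_replicate_mset)
    also have "\<dots> \<le> count S v" by simp
    finally have "size S - k \<le> count S v" using that by (simp add: size_Diff_submset)
    then show False using R v(1) by force
  qed
  moreover have "k \<le> size S" using R \<open>A \<noteq> {}\<close> by force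
  ultimately show "k \<le> size S \<and> (\<forall>F. F \<subseteq># S \<and> size F = k \<longrightarrow> 2 \<le> card (set_mset (S - F)))"
    by blast
qed

text \<open>The argument depends on the graph only through its number of vertices
  \<open>m + 1\<close>; K_{3,3} is the case \<open>m = 5\<close>.\<close>

lemma robust_power_domination_number_if_two_suffice:
  assumes card_verts: "card (verts G) = Suc m" and "m > 0"
    and two: "\<And>S. S \<subseteq> verts G \<Longrightarrow> power_dominating G S \<longleftrightarrow> 2 \<le> card S"
  shows "robust_power_domination_number k G = k + k div m + 2"
proof -
  let ?A = "verts G"
  have A: "finite ?A" "?A \<noteq> {}"
    using card_verts card.infinite by force+
  have robust_iff: "robust_power_dominating k G S \<longleftrightarrow>
      set_mset S \<subseteq> ?A \<and> (\<forall>v\<in>?A. count S v + k < size S)" for S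
  proof (cases "set_mset S \<subseteq> ?A")
    case True
    then have "power_dominating G (set_mset (S - F)) \<longleftrightarrow> 2 \<le> card (set_mset (S - F))" for F
      using two by (meson in_diffD subset_iff)
    then show ?thesis
      using two_le_card_after_removal_iff[OF True A(2)] True
      by (simp add: robust_power_dominating_def)
  qed (simp add: robust_power_dominating_def)
  let ?s = "k + k div m + 2"
  have "\<exists>S. robust_power_dominating k G S \<and> size S = ?s"
  proof -
    \<comment> \<open>For a multiset of size \<open>?s\<close>, \<open>k div m + 1\<close> is the
      largest multiplicity that robustness permits. Giving it to all \<open>m + 1\<close> vertices
      yields at least \<open>?s\<close> elements, and cutting down to size \<open>?s\<close> raises
      no multiplicity.\<close>
    let ?M = "repeat_mset (k div m + 1) (mset_set ?A)"
    have "k mod m < m" "k = k div m * m + k mod m" using \<open>m > 0\<close> by simp_all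
    then have "Suc k \<le> m + k div m * m" by linarith
    then have "?s \<le> size ?M" by (simp add: card_verts)
    then obtain S where S: "S \<subseteq># ?M" "size S = ?s"
      using exists_submset_of_size by blast
    have "set_mset ?M \<subseteq> ?A"
      using A(1) by (metis count_eq_zero_iff count_mset_set(3) count_repeat_mset mult_zero_right subsetI)
    then have "set_mset S \<subseteq> ?A"
      using set_mset_mono[OF S(1)] by blast
    moreover have "count S v \<le> k div m + 1" for v
    proof -
      have "count S v \<le> count ?M v" using S(1) by (rule mset_subset_eq_count)
      also have "\<dots> \<le> k div m + 1" by (simp add: count_mset_set')
      finally show ?thesis .
    qed
    then have "\<forall>v\<in>?A. count S v + k < size S"
      using S(2) by (auto simp: less_Suc_eq_le)
    ultimately show ?thesis using robust_iff S(2) by blast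
  qed
  moreover have "?s \<le> size S" if "robust_power_dominating k G S" for S
  proof -
    obtain v where "v \<in> ?A" using A(2) by blast
    then have "k < size S" using that robust_iff by force
    \<comment> \<open>\<open>d\<close> is the largest multiplicity allowed by
      \<open>count S v + k < size S\<close>.\<close>
    then obtain d where d: "size S = k + 1 + d" using less_iff_Suc_add by auto
    have "size S = (\<Sum>v\<in>set_mset S. count S v)" by (simp add: size_multiset_overloaded_eq)
    also have "\<dots> \<le> (\<Sum>v\<in>?A. count S v)"
      using that robust_iff A(1) by (intro sum_mono2) auto
    also have "\<dots> \<le> (\<Sum>v\<in>?A. d)"
      using that robust_iff d by (intro sum_mono) force
    \<comment> \<open>From \<open>k + 1 + d \<le> (m + 1) * d\<close> one summand \<open>d\<close>
      cancels, which is why the divisor is \<open>m\<close> and not \<open>m + 1\<close>.\<close>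
    finally have "k < m * d" using d card_verts by simp
    then have "k div m < d" using \<open>m > 0\<close> by (simp add: less_mult_imp_div_less mult.commute)
    then show ?thesis using d by simp
  qed
  ultimately show ?thesis
    unfolding robust_power_domination_number_def
    by (intro cInf_eq_minimum) (blast intro: sym)+
qed

theorem theorem4p3:
  fixes G :: "('a, 'b) pre_digraph" and k :: nat
  assumes "complete_bipartite_digraph 3 3 G"
  shows "robust_power_domination_number k G = k + nat \<lfloor>real k / 5\<rfloor> + 2"
proof -
  from assms obtain U V where "K33 G U V"
    unfolding complete_bipartite_digraph_def K33_def by blast
  then interpret K33 G U V .
  have "finite U" "finite V" using cards card.infinite by force+
  then have "card (verts G) = Suc 5"
    using cards disj by (simp add: verts card_Un_disjoint)
  then have "robust_power_domination_number k G = k + k div 5 + 2"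
    using robust_power_domination_number_if_two_suffice[of G 5] power_dominating_iff_card
    by simp
  moreover have "nat \<lfloor>real k / 5\<rfloor> = k div 5"
    using floor_divide_of_nat_eq[of k 5, where ?'a = real] by simp
  ultimately show ?thesis by simp
qed

end
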